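(* Suppose $f(x,\theta)$ is continuously differentiable in $x$ for all $\theta\in\Theta$ and $g$ is continuously differentiable. Suppose: $\|\nabla_x f(x_1,\theta)-\nabla_x f(x_2,\theta)\|\le G_{f,x}\|x_1-x_2\|$ for all $x_1,x_2\in X$, $\theta\in\Theta$; $\nabla_\theta g$ is Lipschitz continuous with constant $G_g$; $f(\cdot,\theta)$ is convex for all $\theta\in\Theta$; $g$ is strongly convex with constant $\eta_g>0$; $X$ and $\Theta$ are compact; and $\|\nabla_x f(x,\theta_1)-\nabla_x f(x,\theta_2)\|\le G_{f,\theta}\|\theta_1-\theta_2\|$ for all $\theta_1,\theta_2\in\Theta$, $x\in X$. Let $\{\gamma_{f,k}\}$ be a diminishing nonnegative sequence with $\sum_{k=1}^\infty\gamma_{f,k}=\infty$ and $\sum_{k=1}^\infty\gamma_{f,k}^2<\infty$, and let $\gamma_{g,k}=\gamma_g$ for all $k$ with $0<\gamma_g<2/G_g$. Let $\{(x_k,\theta_k)\}$ be generated by the joint gradient scheme. Then $\{\theta_k\}$ converges to $\theta^*$, the minimizer of $g$ over $\Theta$, and $\{x_k\}$ converges to a point in $X^*=\operatorname{argmin}_{x\in X}f(x,\theta^* )$.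
   Context: $X\subseteq\mathbb{R}^n$ and $\Theta\subseteq\mathbb{R}^m$ are nonempty closed convex sets, $f:X\times\Theta\to\mathbb{R}$, $g:\mathbb{R}^m\to\mathbb{R}$. $\Pi_Y$ denotes Euclidean projection onto $Y$. A differentiable function $h$ is strongly convex with constant $\eta$ if $(\nabla h(u)-\nabla h(v))^T(u-v)\ge\eta\|u-v\|^2$ for all $u,v$. "Diminishing" means tending to $0$. The joint gradient scheme, given $x_0\in X$, $\theta_0\in\Theta$ and steplengths $\{\gamma_{f,k}\},\{\gamma_{g,k}\}$, is: for all $k\ge0$, $x_{k+1}=\Pi_X(x_k-\gamma_{f,k}\nabla_x f(x_k,\theta_k))$ and $\theta_{k+1}=\Pi_\Theta(\theta_k-\gamma_{g,k}\nabla_\theta g(\theta_k))$. *)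

theory Defs
  imports "HOL-Analysis.Analysis"
begin

text \<open>Relative counterpart of \<open>GDERIV\<close>. The derivative is taken within \<open>S\<close>, so \<open>h\<close> needs to be given
  on \<open>S\<close> only. If \<open>S\<close> has empty interior, \<open>G\<close> need not be determined by \<open>h\<close>.\<close>

definition has_gradient_on :: "('a::real_inner \<Rightarrow> real) \<Rightarrow> ('a \<Rightarrow> 'a) \<Rightarrow> 'a set \<Rightarrow> bool" where
  "has_gradient_on h G S \<longleftrightarrow> (\<forall>u\<in>S. (h has_derivative (\<lambda>v. inner v (G u))) (at u within S))"

definition has_continuous_gradient_on :: "('a::real_inner \<Rightarrow> real) \<Rightarrow> ('a \<Rightarrow> 'a) \<Rightarrow> 'a set \<Rightarrow> bool" where
  "has_continuous_gradient_on h G S \<longleftrightarrow> has_gradient_on h G S \<and> continuous_on S G"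

definition strongly_convex :: "('a::real_inner \<Rightarrow> real) \<Rightarrow> real \<Rightarrow> bool" where
  "strongly_convex h \<eta> \<longleftrightarrow>
    (\<exists>G. (\<forall>u. GDERIV h u :> G u) \<and> (\<forall>u v. inner (G u - G v) (u - v) \<ge> \<eta> * (norm (u - v))\<^sup>2))"

definition argmin_set :: "('a \<Rightarrow> real) \<Rightarrow> 'a set \<Rightarrow> 'a set" where
  "argmin_set h S = {u. is_arg_min h (\<lambda>u. u \<in> S) u}"

text \<open>\<open>closest_point\<close> is the Euclidean projection onto a nonempty closed convex set.\<close>

definition joint_gradient_scheme ::
  "(real^'n) set \<Rightarrow> (real^'m) set \<Rightarrow> (real^'n \<Rightarrow> real^'m \<Rightarrow> real^'n) \<Rightarrow> (real^'m \<Rightarrow> real^'m) \<Rightarrow>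
   (nat \<Rightarrow> real) \<Rightarrow> (nat \<Rightarrow> real) \<Rightarrow> (nat \<Rightarrow> real^'n) \<Rightarrow> (nat \<Rightarrow> real^'m) \<Rightarrow> bool" where
  "joint_gradient_scheme X \<Theta> grad_f grad_g \<gamma>f \<gamma>g x \<theta> \<longleftrightarrow>
    x 0 \<in> X \<and> \<theta> 0 \<in> \<Theta> \<and>
    (\<forall>k. x (Suc k) = closest_point X (x k - \<gamma>f k *\<^sub>R grad_f (x k) (\<theta> k)) \<and>
         \<theta> (Suc k) = closest_point \<Theta> (\<theta> k - \<gamma>g k *\<^sub>R grad_g (\<theta> k)))"

end

theory Submission
  imports Defs
begin

text \<open>The sufficient decrease of \<open>g\<close> makes the squared steps \<open>\<parallel>\<theta>\<^sub>k\<^sub>+\<^sub>1 - \<theta>\<^sub>k\<parallel>\<^sup>2\<close> summable when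
  \<open>\<gamma>\<^sub>g < 2 / G\<^sub>g\<close>, and strong convexity bounds the distance from \<open>\<theta>\<^sub>k\<^sub>+\<^sub>1\<close> to the minimizer by a multiple
  of the step length. Hence \<open>\<parallel>\<theta>\<^sub>k - \<theta>\<^sup>*\<parallel>\<close> is square summable. The \<open>x\<close>-iteration is therefore a
  projected gradient method for \<open>f(\<cdot>, \<theta>\<^sup>*)\<close> whose errors, weighted by the square summable steplengths,
  are summable. It is quasi-Fejer monotone with respect to every minimizer, and since the steplengths
  have divergent sum, some cluster point is a minimizer.\<close>

section \<open>Quasi-Fejer recursions and summability\<close>

text \<open>Subtracting the accumulated errors from \<open>a\<close> leaves a nonincreasing sequence
  that is bounded below because \<open>e\<close> is summable; adding the convergent error sums back
  gives the limit of \<open>a\<close>. Telescoping the same recursion bounds the partial sums of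
  \<open>b\<close>. It serves both iterations: with zero errors for the values of \<open>g\<close>,
  with genuine errors for the squared distances of \<open>x\<close>.\<close>

lemma quasi_fejer:
  fixes a b e :: "nat \<Rightarrow> real"
  assumes "\<And>k. 0 \<le> a k" "\<And>k. 0 \<le> b k" "\<And>k. 0 \<le> e k" "summable e"
    and step: "\<And>k. a (Suc k) \<le> a k - b k + e k"
  shows "convergent a" "summable b"
proof -
  let ?c = "\<lambda>n. a n - sum e {..<n}"
  have le: "sum e {..<n} \<le> suminf e" for n
    using assms by (intro sum_le_suminf) auto
  have "?c (Suc n) \<le> ?c n" for n
    using step[of n] assms(2)[of n] by simp
  then have "decseq ?c"
    by (rule decseq_SucI)
  moreover have "- suminf e \<le> ?c n" for n
    using le[of n] assms(1)[of n] by simp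
  ultimately obtain l where "?c \<longlonglongrightarrow> l"
    using decseq_convergent[of ?c "- suminf e"] by blast
  then have "(\<lambda>n. ?c n + sum e {..<n}) \<longlonglongrightarrow> l + suminf e"
    using assms(4) by (intro tendsto_add summable_LIMSEQ)
  then show "convergent a"
    by (auto simp: convergent_def)
  have sum: "sum b {..<n} \<le> a 0 - a n + sum e {..<n}" for n
  proof (induction n)
    case (Suc n)
    then show ?case using step[of n] by simp
  qed simp
  have "sum b {..<n} \<le> a 0 + suminf e" for n
    using sum[of n] le[of n] assms(1)[of n] by linarith
  then show "summable b"
    by (rule summableI_nonneg_bounded[OF assms(2)])
qed

lemma summable_mult_square:
  fixes a b :: "nat \<Rightarrow> real"
  assumes "summable (\<lambda>k. (a k)\<^sup>2)" "summable (\<lambda>k. (b k)\<^sup>2)"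
  shows "summable (\<lambda>k. a k * b k)"
proof (rule summable_comparison_test)
  show "summable (\<lambda>k. (a k)\<^sup>2 + (b k)\<^sup>2)"
    using assms by (rule summable_add)
  have "norm (a k * b k) \<le> (a k)\<^sup>2 + (b k)\<^sup>2" for k
  proof -
    have "0 \<le> (\<bar>a k\<bar> - \<bar>b k\<bar>)\<^sup>2" by simp
    then have "2 * (\<bar>a k\<bar> * \<bar>b k\<bar>) \<le> (a k)\<^sup>2 + (b k)\<^sup>2"
      by (simp add: power2_diff)
    moreover have "0 \<le> \<bar>a k\<bar> * \<bar>b k\<bar>" by simp
    ultimately show ?thesis unfolding real_norm_def abs_mult by linarith
  qed
  then show "\<exists>N. \<forall>n\<ge>N. norm (a n * b n) \<le> (a n)\<^sup>2 + (b n)\<^sup>2"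
    by blast
qed

section \<open>First-order conditions on a convex set\<close>

text \<open>The derivative is taken within \<open>S\<close> only, so the limit is one-sided along a
  segment that convexity keeps inside \<open>S\<close>. Even where \<open>h\<close> does not
  determine \<open>D\<close>, it determines the inner products of \<open>D\<close> with directions
  towards points of \<open>S\<close>, and the arguments below use the derivative within
  \<open>S\<close> only through these.\<close>

lemma directional_difference_quotient:
  fixes u v D :: "'a::real_inner"
  assumes "convex S" "u \<in> S" "v \<in> S"
    and "(h has_derivative (\<lambda>w. inner w D)) (at u within S)"
  shows "((\<lambda>t. (h (u + t *\<^sub>R (v - u)) - h u) / t) \<longlongrightarrow> inner (v - u) D) (at_right 0)"
proof -
  let ?p = "\<lambda>t::real. u + t *\<^sub>R (v - u)"
  have "?p t \<in> S" if "t \<in> {0..1}" for t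
    using convexD_alt[OF assms(1-3), of t] that by (simp add: algebra_simps)
  then have sub: "?p ` {0..1} \<subseteq> S" by auto
  have "(?p has_derivative (\<lambda>t. t *\<^sub>R (v - u))) (at 0 within {0..1})"
    by (auto intro!: derivative_eq_intros)
  then have "(h \<circ> ?p has_derivative (\<lambda>w. inner w D) \<circ> (\<lambda>t. t *\<^sub>R (v - u))) (at 0 within {0..1})"
    using assms(4) sub by (intro diff_chain_within) (auto intro: has_derivative_subset)
  then have "((\<lambda>t. h (?p t)) has_field_derivative inner (v - u) D) (at 0 within {0..1})"
    by (simp add: has_field_derivative_def o_def mult_commute_abs)
  then have "((\<lambda>t. (h (?p t) - h u) / t) \<longlongrightarrow> inner (v - u) D) (at 0 within {0..1})"
    by (simp add: has_field_derivative_iff)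
  then show ?thesis
    by (simp add: at_within_Icc_at_right)
qed

text \<open>Convexity bounds every difference quotient with 0 < t < 1 by \<open>h v - h u\<close>,
  and the bound survives the limit.\<close>

lemma convex_on_above_tangent:
  fixes u v D :: "'a::real_inner"
  assumes "convex_on S h" "u \<in> S" "v \<in> S"
    and "(h has_derivative (\<lambda>w. inner w D)) (at u within S)"
  shows "h u + inner (v - u) D \<le> h v"
proof -
  have "eventually (\<lambda>t::real. t \<in> {0<..<1}) (at_right 0)"
    by (rule eventually_at_right_real) simp
  then have "eventually (\<lambda>t. (h (u + t *\<^sub>R (v - u)) - h u) / t \<le> h v - h u) (at_right 0)"
  proof eventually_elim
    case (elim t)
    have "h ((1 - t) *\<^sub>R u + t *\<^sub>R v) \<le> (1 - t) * h u + t * h v"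
      using assms elim by (intro convex_onD[OF assms(1)]) auto
    moreover have "(1 - t) *\<^sub>R u + t *\<^sub>R v = u + t *\<^sub>R (v - u)"
      by (simp add: algebra_simps)
    ultimately show ?case
      using elim by (simp add: field_simps)
  qed
  then have "inner (v - u) D \<le> h v - h u"
    using directional_difference_quotient[OF convex_on_imp_convex[OF assms(1)] assms(2-4)]
    by (intro tendsto_upperbound) auto
  then show ?thesis by simp
qed

text \<open>At a minimizer the difference quotients towards points of \<open>S\<close> are
  nonnegative, hence so is their limit.\<close>

lemma argmin_variational_inequality:
  fixes u v D :: "'a::real_inner"
  assumes "convex S" "u \<in> argmin_set h S" "v \<in> S"
    and "(h has_derivative (\<lambda>w. inner w D)) (at u within S)"
  shows "0 \<le> inner (v - u) D"
proof -
  have u: "u \<in> S" "\<And>w. w \<in> S \<Longrightarrow> h u \<le> h w"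
    using assms(2) by (auto simp: argmin_set_def is_arg_min_def not_less)
  have "eventually (\<lambda>t::real. t \<in> {0<..<1}) (at_right 0)"
    by (rule eventually_at_right_real) simp
  then have "eventually (\<lambda>t. 0 \<le> (h (u + t *\<^sub>R (v - u)) - h u) / t) (at_right 0)"
  proof eventually_elim
    case (elim t)
    have "u + t *\<^sub>R (v - u) \<in> S"
      using convexD_alt[OF assms(1) u(1) assms(3), of t] elim by (simp add: algebra_simps)
    then show ?case
      using elim u(2) by simp
  qed
  then show ?thesis
    using directional_difference_quotient[OF assms(1) u(1) assms(3-4)]
    by (intro tendsto_lowerbound) auto
qed

lemma argmin_set_nonempty:
  assumes "compact S" "S \<noteq> {}" "continuous_on S h"
  shows "argmin_set h S \<noteq> {}"
  using continuous_attains_inf[OF assms]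
  by (auto simp: argmin_set_def is_arg_min_def not_less)

section \<open>Projected gradient steps for a strongly convex function\<close>

lemma lipschitz_gradient_descent:
  fixes u v :: "'a::real_inner"
  assumes "\<And>w. GDERIV h w :> G w" "L-lipschitz_on UNIV G"
  shows "h v \<le> h u + inner (v - u) (G u) + L / 2 * (norm (v - u))\<^sup>2"
proof -
  let ?p = "\<lambda>t::real. u + t *\<^sub>R (v - u)"
  \<comment> \<open>\<open>?\<phi>\<close> is \<open>h\<close> along the segment minus the linear
    term and the quadratic term of the claimed bound. Cauchy-Schwarz and the Lipschitz condition
    make its derivative nonpositive, so comparing its values at 1 and 0 is the claim.\<close>
  let ?\<phi> = "\<lambda>t. h (?p t) - t * inner (v - u) (G u) - L / 2 * t\<^sup>2 * (norm (v - u))\<^sup>2"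
  have "\<exists>y. (?\<phi> has_real_derivative y) (at t) \<and> y \<le> 0" if "0 \<le> t" "t \<le> 1" for t
  proof (intro exI conjI)
    have "(?p has_derivative (\<lambda>t. t *\<^sub>R (v - u))) (at t)"
      by (auto intro!: derivative_eq_intros)
    then have "(h \<circ> ?p has_derivative (\<lambda>w. inner w (G (?p t))) \<circ> (\<lambda>t. t *\<^sub>R (v - u))) (at t)"
      using assms(1)[of "?p t"] by (intro diff_chain_at) (auto simp: gderiv_def)
    then have "((\<lambda>t. h (?p t)) has_real_derivative inner (v - u) (G (?p t))) (at t)"
      by (simp add: has_field_derivative_def o_def mult_commute_abs)
    then show "(?\<phi> has_real_derivative inner (v - u) (G (?p t)) - inner (v - u) (G u)
        - L * t * (norm (v - u))\<^sup>2) (at t)"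
      by (auto intro!: derivative_eq_intros)
    have "inner (v - u) (G (?p t)) - inner (v - u) (G u) = inner (v - u) (G (?p t) - G u)"
      by (simp add: inner_diff_right)
    also have "\<dots> \<le> norm (v - u) * norm (G (?p t) - G u)"
      by (rule norm_cauchy_schwarz)
    also have "norm (G (?p t) - G u) \<le> L * norm (t *\<^sub>R (v - u))"
      using lipschitz_onD[OF assms(2), of "?p t" u] by (simp add: dist_norm)
    also have "norm (v - u) * (L * norm (t *\<^sub>R (v - u))) = L * t * (norm (v - u))\<^sup>2"
      using that by (simp add: power2_eq_square)
    finally show "inner (v - u) (G (?p t)) - inner (v - u) (G u) - L * t * (norm (v - u))\<^sup>2 \<le> 0"
      by (simp add: mult_left_mono)
  qed
  then have "?\<phi> 1 \<le> ?\<phi> 0"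
    by (intro DERIV_nonpos_imp_nonincreasing[of 0 1]) auto
  then show ?thesis by simp
qed

text \<open>Testing the variational inequality at each minimizer with the other one and adding shows
  that the strongly monotone expression is at most 0.\<close>

lemma strongly_convex_argmin_unique:
  fixes S :: "'a::real_inner set"
  assumes "convex S" "\<And>w. GDERIV g w :> G w" "\<eta> > 0"
    and sm: "\<And>u v. \<eta> * (norm (u - v))\<^sup>2 \<le> inner (G u - G v) (u - v)"
    and "u \<in> argmin_set g S" "v \<in> argmin_set g S"
  shows "u = v"
proof -
  have S: "u \<in> S" "v \<in> S"
    using assms(5,6) by (auto simp: argmin_set_def is_arg_min_def)
  have D: "(g has_derivative (\<lambda>h. inner h (G w))) (at w within S)" for w
    using assms(2)[of w] by (auto simp: gderiv_def intro: has_derivative_at_withinI)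
  have "0 \<le> inner (v - u) (G u)" "0 \<le> inner (u - v) (G v)"
    using argmin_variational_inequality[OF assms(1) _ _ D] assms(5,6) S by blast+
  then have "\<eta> * (norm (u - v))\<^sup>2 \<le> 0"
    using sm[of u v] by (simp add: inner_diff_left inner_diff_right inner_commute)
  then show ?thesis
    using \<open>\<eta> > 0\<close> by (simp add: mult_le_0_iff)
qed

lemma projected_gradient_square_summable:
  fixes S :: "'a::euclidean_space set" and y :: "nat \<Rightarrow> 'a"
  assumes S: "convex S" "closed S"
    and G: "\<And>w. GDERIV g w :> G w" "L-lipschitz_on UNIV G"
    and sm: "\<eta> > 0" "\<And>u v. \<eta> * (norm (u - v))\<^sup>2 \<le> inner (G u - G v) (u - v)"
    and \<gamma>: "0 < \<gamma>" "\<gamma> < 2 / L"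
    and y: "y 0 \<in> S" "\<And>k. y (Suc k) = closest_point S (y k - \<gamma> *\<^sub>R G (y k))"
    and s: "s \<in> argmin_set g S"
  shows "summable (\<lambda>k. (norm (y k - s))\<^sup>2)"
proof -
  \<comment> \<open>For \<open>L = 0\<close> the quotient \<open>2 / L\<close> is 0, which
    contradicts the two bounds on \<open>\<gamma>\<close>.\<close>
  have L: "L > 0"
    using \<gamma> lipschitz_on_nonneg[OF G(2)] by (cases "L = 0") auto
  have sS: "s \<in> S" and min: "\<And>w. w \<in> S \<Longrightarrow> g s \<le> g w"
    using s by (auto simp: argmin_set_def is_arg_min_def not_less)
  have yS: "y k \<in> S" for k
    using y sS S by (cases k) (auto intro!: closest_point_in_set)
  have proj: "inner (y k - \<gamma> *\<^sub>R G (y k) - y (Suc k)) (w - y (Suc k)) \<le> 0" if "w \<in> S" for k w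
    using closest_point_dot[OF S that] y(2) by simp
  let ?d = "\<lambda>k. y (Suc k) - y k"
  \<comment> \<open>The projection inequality tested at \<open>y k\<close> gives a first-order
    decrease of \<open>1 / \<gamma>\<close> times the squared step, and the curvature term of the
    descent lemma costs \<open>L / 2\<close> times it. The difference is positive because
    \<open>\<gamma> < 2 / L\<close>.\<close>
  define c where "c = 1 / \<gamma> - L / 2"
  have c: "c > 0"
    using \<gamma> L by (simp add: c_def field_simps)
  have "summable (\<lambda>k. c * (norm (?d k))\<^sup>2)"
  proof (rule quasi_fejer(2)[where a = "\<lambda>k. g (y k) - g s" and e = "\<lambda>_. 0"])
    fix k
    have "(norm (?d k))\<^sup>2 + \<gamma> * inner (?d k) (G (y k)) \<le> 0"
      using proj[OF yS[of k], of k]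
      by (simp add: power2_norm_eq_inner inner_commute algebra_simps)
    then have "inner (?d k) (G (y k)) \<le> - (1 / \<gamma>) * (norm (?d k))\<^sup>2"
      using \<gamma>(1) by (simp add: field_simps)
    then have "g (y (Suc k)) \<le> g (y k) - c * (norm (?d k))\<^sup>2"
      using lipschitz_gradient_descent[OF G, of "y (Suc k)" "y k"]
      by (simp add: c_def algebra_simps)
    then show "g (y (Suc k)) - g s \<le> g (y k) - g s - c * (norm (?d k))\<^sup>2 + 0"
      by simp
  qed (use min yS c in auto)
  then have d: "summable (\<lambda>k. (norm (?d k))\<^sup>2)"
    using c by (simp add: summable_cmult_iff)
  \<comment> \<open>Error bound: strong monotonicity between \<open>y (Suc k)\<close> and
    \<open>s\<close> is combined with the variational inequality at \<open>s\<close> and the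
    projection inequality tested at \<open>s\<close>. What remains is controlled by the step length,
    with a factor \<open>L\<close> from the change of gradient and \<open>1 / \<gamma>\<close> from
    the projection residual.\<close>
  define C where "C = (L + 1 / \<gamma>) / \<eta>"
  have bound: "norm (y (Suc k) - s) \<le> C * norm (?d k)" for k
  proof -
    let ?z = "y (Suc k)"
    have "0 \<le> inner (?z - s) (G s)"
      using argmin_variational_inequality[OF S(1) s yS] G(1)[of s]
      by (auto simp: gderiv_def intro: has_derivative_at_withinI)
    moreover have "\<gamma> * inner (G (y k)) (?z - s) \<le> inner (y k - ?z) (?z - s)"
      using proj[OF sS, of k] by (simp add: algebra_simps)
    then have "inner (G (y k)) (?z - s) \<le> inner ((1 / \<gamma>) *\<^sub>R (y k - ?z)) (?z - s)"
      using \<gamma>(1) by (simp add: pos_le_divide_eq mult.commute del: scaleR_right_diff_distrib)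
    ultimately have "\<eta> * (norm (?z - s))\<^sup>2 \<le> inner (G ?z - G (y k) + (1 / \<gamma>) *\<^sub>R (y k - ?z)) (?z - s)"
      using sm(2)[of ?z s] by (simp only: inner_diff_left inner_add_left inner_commute[of "G s"])
    also have "\<dots> \<le> norm (G ?z - G (y k) + (1 / \<gamma>) *\<^sub>R (y k - ?z)) * norm (?z - s)"
      by (rule norm_cauchy_schwarz)
    also have "norm (G ?z - G (y k) + (1 / \<gamma>) *\<^sub>R (y k - ?z)) \<le> norm (G ?z - G (y k)) + norm ((1 / \<gamma>) *\<^sub>R (y k - ?z))"
      by (rule norm_triangle_ineq)
    also have "\<dots> \<le> (L + 1 / \<gamma>) * norm (?d k)"
      using lipschitz_onD[OF G(2), of ?z "y k"] \<gamma>(1)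
      by (simp add: dist_norm norm_minus_commute distrib_right del: scaleR_right_diff_distrib)
    finally have "\<eta> * norm (?z - s) * norm (?z - s) \<le> (L + 1 / \<gamma>) * norm (?d k) * norm (?z - s)"
      by (simp add: power2_eq_square mult_right_mono mult.assoc)
    \<comment> \<open>The common factor \<open>norm (?z - s)\<close> can be cancelled only if it is
      nonzero; otherwise the bound is trivial.\<close>
    then have "?z = s \<or> \<eta> * norm (?z - s) \<le> (L + 1 / \<gamma>) * norm (?d k)"
      by (metis mult_le_cancel_right_pos zero_less_norm_iff right_minus_eq)
    then show ?thesis
      using sm(1) L \<gamma>(1) by (auto simp: C_def field_simps)
  qed
  have "summable (\<lambda>k. (norm (y (Suc k) - s))\<^sup>2)"
  proof (rule summable_comparison_test)
    show "summable (\<lambda>k. C\<^sup>2 * (norm (?d k))\<^sup>2)"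
      using d by (rule summable_mult)
    have "(norm (y (Suc k) - s))\<^sup>2 \<le> C\<^sup>2 * (norm (?d k))\<^sup>2" for k
      using power_mono[OF bound[of k], of 2] by (simp add: power_mult_distrib)
    then show "\<exists>N. \<forall>n\<ge>N. norm ((norm (y (Suc n) - s))\<^sup>2) \<le> C\<^sup>2 * (norm (?d n))\<^sup>2"
      by auto
  qed
  then show ?thesis
    using summable_Suc_iff[of "\<lambda>k. (norm (y k - s))\<^sup>2"] by simp
qed

section \<open>Inexact projected gradient steps for a convex function\<close>

text \<open>Here \<open>d\<close> is the direction actually used and \<open>G\<close> the exact
  gradient of \<open>h\<close> at \<open>u\<close>. The projection is nonexpansive and fixes
  \<open>z\<close>; after expanding the square, replacing \<open>d\<close> by \<open>G\<close> costs
  at most \<open>\<epsilon> * D\<close>, and the tangent inequality turns the inner product into a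
  gap of function values.\<close>

lemma projected_gradient_step:
  fixes S :: "'a::euclidean_space set"
  assumes S: "convex S" "closed S" and z: "z \<in> S" and "0 \<le> \<gamma>"
    and D: "norm (u - z) \<le> D" and M: "norm d \<le> M" and err: "norm (d - G) \<le> \<epsilon>"
    and tangent: "h u + inner (z - u) G \<le> h z"
  shows "(norm (closest_point S (u - \<gamma> *\<^sub>R d) - z))\<^sup>2
    \<le> (norm (u - z))\<^sup>2 - 2 * \<gamma> * (h u - h z) + (2 * D * (\<gamma> * \<epsilon>) + M\<^sup>2 * \<gamma>\<^sup>2)"
proof -
  have "norm (closest_point S (u - \<gamma> *\<^sub>R d) - z) \<le> norm (u - \<gamma> *\<^sub>R d - z)"
    using closest_point_lipschitz[OF S, of "u - \<gamma> *\<^sub>R d" z] z closest_point_self[OF z]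
    by (auto simp: dist_norm)
  then have "(norm (closest_point S (u - \<gamma> *\<^sub>R d) - z))\<^sup>2 \<le> (norm (u - \<gamma> *\<^sub>R d - z))\<^sup>2"
    by (simp add: power_mono)
  also have "\<dots> = (norm (u - z))\<^sup>2 - 2 * \<gamma> * inner d (u - z) + \<gamma>\<^sup>2 * (norm d)\<^sup>2"
    unfolding power2_norm_eq_inner
    by (simp add: inner_commute power2_eq_square algebra_simps)
  finally have 1: "(norm (closest_point S (u - \<gamma> *\<^sub>R d) - z))\<^sup>2
    \<le> (norm (u - z))\<^sup>2 - 2 * \<gamma> * inner d (u - z) + \<gamma>\<^sup>2 * (norm d)\<^sup>2" .
  have "- inner (d - G) (u - z) \<le> norm (d - G) * norm (u - z)"
    using Cauchy_Schwarz_ineq2[of "d - G" "u - z"] by linarith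
  also have "\<dots> \<le> \<epsilon> * D"
    using err D order_trans[OF norm_ge_zero err] by (intro mult_mono) auto
  finally have "h u - h z - \<epsilon> * D \<le> inner d (u - z)"
    using tangent by (simp add: inner_diff_left inner_diff_right inner_commute)
  then have 2: "2 * \<gamma> * (h u - h z - \<epsilon> * D) \<le> 2 * \<gamma> * inner d (u - z)"
    using \<open>0 \<le> \<gamma>\<close> by (intro mult_left_mono) auto
  have 3: "\<gamma>\<^sup>2 * (norm d)\<^sup>2 \<le> \<gamma>\<^sup>2 * M\<^sup>2"
    using M by (intro mult_left_mono power_mono) auto
  show ?thesis
    using 1 2 3 by (simp add: algebra_simps)
qed

lemma divergent_weights_frequently_small:
  fixes w a :: "nat \<Rightarrow> real"
  assumes "\<And>k. 0 \<le> w k" "\<And>k. 0 \<le> a k" "\<not> summable w" "summable (\<lambda>k. w k * a k)" "0 < \<epsilon>"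
  shows "\<exists>k\<ge>n. a k < \<epsilon>"
proof (rule ccontr)
  assume "\<not> ?thesis"
  then have ge: "\<epsilon> \<le> a k" if "k \<ge> n" for k
    using that by force
  have "summable (\<lambda>k. w k * \<epsilon>)"
  proof (rule summable_comparison_test[OF _ assms(4)])
    have "norm (w k * \<epsilon>) \<le> w k * a k" if "k \<ge> n" for k
      using ge[OF that] assms(1)[of k] \<open>0 < \<epsilon>\<close> by (simp add: mult_left_mono)
    then show "\<exists>N. \<forall>k\<ge>N. norm (w k * \<epsilon>) \<le> w k * a k"
      by blast
  qed
  then show False
    using assms(3,5) by (simp add: summable_cmult_iff mult.commute[of _ \<epsilon>])
qed

text \<open>Values close to the minimum recur arbitrarily late, so compactness and continuity
  provide a cluster point \<open>z\<close> that is a minimizer. The squared distance to this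
  particular \<open>z\<close> converges, and its limit is 0 since it vanishes along a
  subsequence.\<close>

lemma fejer_convergence_to_argmin:
  fixes X :: "'a::real_normed_vector set"
  assumes X: "compact X" "\<And>k. x k \<in> X" and h: "continuous_on X h"
    and fejer: "\<And>z. z \<in> argmin_set h X \<Longrightarrow> convergent (\<lambda>k. (norm (x k - z))\<^sup>2)"
    and p: "p \<in> X" and small: "\<And>\<epsilon> n. 0 < \<epsilon> \<Longrightarrow> \<exists>k\<ge>n. h (x k) - h p < \<epsilon>" and min: "\<And>w. w \<in> X \<Longrightarrow> h p \<le> h w"
  shows "\<exists>z \<in> argmin_set h X. x \<longlonglongrightarrow> z"
proof -
  have "\<exists>k\<ge>n. h (x k) - h p < 1 / real (Suc n)" for n
    by (rule small) simp
  then obtain k where k: "\<And>n. n \<le> k n" "\<And>n. h (x (k n)) - h p < 1 / real (Suc n)"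
    by metis
  obtain z r where z: "z \<in> X" and r: "strict_mono r" "((x \<circ> k) \<circ> r) \<longlonglongrightarrow> z"
    using X by (metis comp_apply compact_def)
  have lim: "(\<lambda>n. h (x (k (r n)))) \<longlonglongrightarrow> h z"
    using continuous_on_tendsto_compose[OF h r(2) z] X(2) by (simp add: o_def)
  have "(\<lambda>n. h p + 1 / real (Suc (r n))) \<longlonglongrightarrow> h p + 0"
    using LIMSEQ_subseq_LIMSEQ[OF LIMSEQ_inverse_real_of_nat r(1)]
    by (intro tendsto_add tendsto_const) (simp add: o_def inverse_eq_divide)
  then have "h z \<le> h p + 0"
    using lim k(2) by (intro LIMSEQ_le[OF lim]) (auto simp: less_imp_le algebra_simps)
  then have za: "z \<in> argmin_set h X"
    using z min by (force simp: argmin_set_def is_arg_min_def)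
  then obtain l where l: "(\<lambda>k. (norm (x k - z))\<^sup>2) \<longlonglongrightarrow> l"
    using fejer by (auto simp: convergent_def)
  \<comment> \<open>The indices \<open>k (r n)\<close> need not increase with \<open>n\<close>; it
    is enough that they tend to infinity.\<close>
  have "r n \<le> k (r n)" for n by (rule k(1))
  then have "filterlim (\<lambda>n. k (r n)) sequentially sequentially"
    using filterlim_subseq[OF r(1)] by (auto intro: filterlim_at_top_mono)
  then have "(\<lambda>n. (norm (x (k (r n)) - z))\<^sup>2) \<longlonglongrightarrow> l"
    by (rule filterlim_compose[OF l])
  moreover have "(\<lambda>n. (norm (x (k (r n)) - z))\<^sup>2) \<longlonglongrightarrow> (norm (z - z))\<^sup>2"
    using r(2) by (intro tendsto_intros) (simp add: o_def)
  ultimately have "l = (norm (z - z))\<^sup>2"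
    by (rule LIMSEQ_unique)
  with l have "(\<lambda>k. (norm (x k - z))\<^sup>2) \<longlonglongrightarrow> 0" by simp
  then have "(\<lambda>k. sqrt ((norm (x k - z))\<^sup>2)) \<longlonglongrightarrow> sqrt 0"
    by (rule tendsto_real_sqrt)
  then have "x \<longlonglongrightarrow> z"
    by (simp add: tendsto_norm_zero_iff LIM_zero_iff)
  with za show ?thesis by blast
qed

section \<open>Convergence of the joint scheme\<close>

theorem proposition7:
  fixes X :: "(real^'n) set" and \<Theta> :: "(real^'m) set"
    and f :: "real^'n \<Rightarrow> real^'m \<Rightarrow> real" and g :: "real^'m \<Rightarrow> real"
    and grad_f :: "real^'n \<Rightarrow> real^'m \<Rightarrow> real^'n" and grad_g :: "real^'m \<Rightarrow> real^'m"
    and Gfx Gf\<theta> Gg \<eta>g \<gamma>g :: real and \<gamma>f :: "nat \<Rightarrow> real"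
    and x :: "nat \<Rightarrow> real^'n" and \<theta> :: "nat \<Rightarrow> real^'m"
  assumes "X \<noteq> {}" "closed X" "convex X" "compact X"
    and "\<Theta> \<noteq> {}" "closed \<Theta>" "convex \<Theta>" "compact \<Theta>"
    and "\<And>t. t \<in> \<Theta> \<Longrightarrow> has_continuous_gradient_on (\<lambda>u. f u t) (\<lambda>u. grad_f u t) X"
    and "has_continuous_gradient_on g grad_g UNIV"
    and "\<And>u v t. u \<in> X \<Longrightarrow> v \<in> X \<Longrightarrow> t \<in> \<Theta> \<Longrightarrow>
          norm (grad_f u t - grad_f v t) \<le> Gfx * norm (u - v)"
    and "Gg-lipschitz_on UNIV grad_g"
    and "\<And>t. t \<in> \<Theta> \<Longrightarrow> convex_on X (\<lambda>u. f u t)"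
    and "\<eta>g > 0" "strongly_convex g \<eta>g"
    and "\<And>u s t. u \<in> X \<Longrightarrow> s \<in> \<Theta> \<Longrightarrow> t \<in> \<Theta> \<Longrightarrow>
          norm (grad_f u s - grad_f u t) \<le> Gf\<theta> * norm (s - t)"
    and "\<And>k. \<gamma>f k \<ge> 0" "\<gamma>f \<longlonglongrightarrow> 0"
    and "filterlim (\<lambda>N. \<Sum>k=1..N. \<gamma>f k) at_top sequentially"
    and "summable (\<lambda>k. (\<gamma>f (Suc k))\<^sup>2)"
    and "0 < \<gamma>g" "\<gamma>g < 2 / Gg"
    and "joint_gradient_scheme X \<Theta> grad_f grad_g \<gamma>f (\<lambda>k. \<gamma>g) x \<theta>"
  shows "\<exists>\<theta>s. argmin_set g \<Theta> = {\<theta>s} \<and> \<theta> \<longlonglongrightarrow> \<theta>s \<and>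
          (\<exists>xs \<in> argmin_set (\<lambda>u. f u \<theta>s) X. x \<longlonglongrightarrow> xs)"
proof -
  note X = assms(1-4) and T = assms(5-8) and f = assms(9) and lipx = assms(11)
    and lipg = assms(12) and conv = assms(13) and lip\<theta> = assms(16) and \<gamma>0 = assms(17)
  have Dg: "GDERIV g u :> grad_g u" for u
    using assms(10) by (simp add: has_continuous_gradient_on_def has_gradient_on_def gderiv_def)
  obtain G where G: "\<And>u. GDERIV g u :> G u"
    "\<And>u v. inner (G u - G v) (u - v) \<ge> \<eta>g * (norm (u - v))\<^sup>2"
    using assms(15) by (auto simp: strongly_convex_def)
  \<comment> \<open>\<open>strongly_convex\<close> only asserts that some gradient is strongly
    monotone; uniqueness of derivatives on the whole space identifies it with
    \<open>grad_g\<close>.\<close>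
  have "G = grad_g"
  proof
    fix u
    have "(\<lambda>v. inner v (G u)) = (\<lambda>v. inner v (grad_g u))"
      using G(1)[of u] Dg[of u] by (auto simp: gderiv_def intro: has_derivative_unique)
    then show "G u = grad_g u"
      by (metis vector_eq_ldot)
  qed
  with G(2) have sm: "\<eta>g * (norm (u - v))\<^sup>2 \<le> inner (grad_g u - grad_g v) (u - v)" for u v
    by simp
  have x0: "x 0 \<in> X" and \<theta>0: "\<theta> 0 \<in> \<Theta>"
    and xS: "\<And>k. x (Suc k) = closest_point X (x k - \<gamma>f k *\<^sub>R grad_f (x k) (\<theta> k))"
    and \<theta>S: "\<And>k. \<theta> (Suc k) = closest_point \<Theta> (\<theta> k - \<gamma>g *\<^sub>R grad_g (\<theta> k))"
    using assms(23) by (auto simp: joint_gradient_scheme_def)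
  have xX: "x k \<in> X" for k
    using x0 xS X by (cases k) (auto intro!: closest_point_in_set)
  have \<theta>T: "\<theta> k \<in> \<Theta>" for k
    using \<theta>0 \<theta>S T by (cases k) (auto intro!: closest_point_in_set)

  have "continuous_on \<Theta> g"
    using Dg by (intro has_derivative_continuous_on[OF has_derivative_at_withinI]) (simp add: gderiv_def)
  then obtain s where s: "s \<in> argmin_set g \<Theta>"
    using argmin_set_nonempty[OF T(4,1)] by blast
  then have arg: "argmin_set g \<Theta> = {s}"
    using strongly_convex_argmin_unique[OF T(3) Dg assms(14) sm _ s] by blast
  have sT: "s \<in> \<Theta>"
    using s by (auto simp: argmin_set_def is_arg_min_def)
  have sum\<theta>: "summable (\<lambda>k. (norm (\<theta> k - s))\<^sup>2)"
    by (rule projected_gradient_square_summable[OF T(3,2) Dg lipg assms(14) sm assms(21,22) \<theta>0 \<theta>S s])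
  have "(\<lambda>k. sqrt ((norm (\<theta> k - s))\<^sup>2)) \<longlonglongrightarrow> sqrt 0"
    by (rule tendsto_real_sqrt[OF summable_LIMSEQ_zero[OF sum\<theta>]])
  then have \<theta>lim: "\<theta> \<longlonglongrightarrow> s"
    by (simp add: tendsto_norm_zero_iff LIM_zero_iff)

  let ?h = "\<lambda>u. f u s"
  have Dh: "(?h has_derivative (\<lambda>v. inner v (grad_f u s))) (at u within X)" if "u \<in> X" for u
    using f[OF sT] that by (simp add: has_continuous_gradient_on_def has_gradient_on_def)
  then have conth: "continuous_on X ?h"
    by (rule has_derivative_continuous_on)
  obtain D where D: "\<And>u v. u \<in> X \<Longrightarrow> v \<in> X \<Longrightarrow> norm (u - v) \<le> D"
    using compact_imp_bounded[OF X(4)] unfolding bounded_two_points dist_norm by blast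
  obtain E where E: "\<And>u v. u \<in> \<Theta> \<Longrightarrow> v \<in> \<Theta> \<Longrightarrow> norm (u - v) \<le> E"
    using compact_imp_bounded[OF T(4)] unfolding bounded_two_points dist_norm by blast
  have D0: "0 \<le> D"
    using D[OF x0 x0] by simp
  \<comment> \<open>A uniform gradient bound: start from the gradient at \<open>(x 0, s)\<close> and
    add its largest variation in each argument over the compact sets. The absolute values allow for
    Lipschitz constants of unspecified sign.\<close>
  define M where "M = norm (grad_f (x 0) s) + \<bar>Gfx\<bar> * D + \<bar>Gf\<theta>\<bar> * E"
  have M: "norm (grad_f u t) \<le> M" if "u \<in> X" "t \<in> \<Theta>" for u t
  proof -
    have "norm (grad_f u t - grad_f u s) \<le> Gf\<theta> * norm (t - s)"
      using lip\<theta> that sT by blast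
    also have "\<dots> \<le> \<bar>Gf\<theta>\<bar> * E"
      using E[OF that(2) sT] by (intro mult_mono) auto
    finally have 1: "norm (grad_f u t - grad_f u s) \<le> \<bar>Gf\<theta>\<bar> * E" .
    have "norm (grad_f u s - grad_f (x 0) s) \<le> Gfx * norm (u - x 0)"
      using lipx that sT x0 by blast
    also have "\<dots> \<le> \<bar>Gfx\<bar> * D"
      using D[OF that(1) x0] by (intro mult_mono) auto
    finally have 2: "norm (grad_f u s - grad_f (x 0) s) \<le> \<bar>Gfx\<bar> * D" .
    have "grad_f u t = (grad_f u t - grad_f u s) + ((grad_f u s - grad_f (x 0) s) + grad_f (x 0) s)"
      by simp
    also have "norm \<dots> \<le> \<bar>Gf\<theta>\<bar> * E + (\<bar>Gfx\<bar> * D + norm (grad_f (x 0) s))"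
      using 1 2 by (intro norm_triangle_mono order_refl)
    finally show ?thesis
      by (simp add: M_def)
  qed
  \<comment> \<open>The error of \<open>projected_gradient_step\<close> when the gradient at
    \<open>\<theta> k\<close> stands in for the one at \<open>s\<close>.\<close>
  define e where "e = (\<lambda>k. 2 * D * (\<gamma>f k * (\<bar>Gf\<theta>\<bar> * norm (\<theta> k - s))) + M\<^sup>2 * (\<gamma>f k)\<^sup>2)"
  have sum\<gamma>: "summable (\<lambda>k. (\<gamma>f k)\<^sup>2)"
    using assms(20) summable_Suc_iff[of "\<lambda>k. (\<gamma>f k)\<^sup>2"] by simp
  \<comment> \<open>The mixed term is a product of two square summable sequences. Mere convergence
    of \<open>\<theta>\<close> to \<open>s\<close> would not make it summable.\<close>
  have "summable (\<lambda>k. 2 * D * \<bar>Gf\<theta>\<bar> * (\<gamma>f k * norm (\<theta> k - s)) + M\<^sup>2 * (\<gamma>f k)\<^sup>2)"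
    using sum\<gamma> sum\<theta> by (intro summable_add summable_mult summable_mult_square) auto
  then have e: "summable e"
    by (simp add: e_def mult_ac)
  have e0: "0 \<le> e k" for k
    using \<gamma>0[of k] D0 by (simp add: e_def)
  \<comment> \<open>The recursion holds for every minimizer \<open>z\<close>, as needed because the
    eventual limit is not known in advance. The weighted sum of the gaps is used only for one fixed
    minimizer \<open>p\<close>.\<close>
  have fejer: "convergent (\<lambda>k. (norm (x k - z))\<^sup>2) \<and> summable (\<lambda>k. 2 * \<gamma>f k * (?h (x k) - ?h z))"
    if "z \<in> argmin_set ?h X" for z
  proof -
    have z: "z \<in> X" and zmin: "\<And>u. u \<in> X \<Longrightarrow> ?h z \<le> ?h u"
      using that by (auto simp: argmin_set_def is_arg_min_def not_less)
    have "(norm (x (Suc k) - z))\<^sup>2 \<le> (norm (x k - z))\<^sup>2 - 2 * \<gamma>f k * (?h (x k) - ?h z) + e k" for k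
      unfolding xS e_def
    proof (rule projected_gradient_step[OF X(3,2) z \<gamma>0 D[OF xX z] M[OF xX \<theta>T]])
      have "norm (grad_f (x k) (\<theta> k) - grad_f (x k) s) \<le> Gf\<theta> * norm (\<theta> k - s)"
        using lip\<theta> xX \<theta>T sT by blast
      also have "\<dots> \<le> \<bar>Gf\<theta>\<bar> * norm (\<theta> k - s)"
        by (intro mult_right_mono) auto
      finally show "norm (grad_f (x k) (\<theta> k) - grad_f (x k) s) \<le> \<bar>Gf\<theta>\<bar> * norm (\<theta> k - s)" .
      show "?h (x k) + inner (z - x k) (grad_f (x k) s) \<le> ?h z"
        by (rule convex_on_above_tangent[OF conv[OF sT] xX z Dh[OF xX]])
    qed
    moreover have "0 \<le> 2 * \<gamma>f k * (?h (x k) - ?h z)" for k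
      using \<gamma>0[of k] zmin[OF xX[of k]] by simp
    ultimately show ?thesis
      using quasi_fejer[of "\<lambda>k. (norm (x k - z))\<^sup>2" "\<lambda>k. 2 * \<gamma>f k * (?h (x k) - ?h z)" e] e e0 by auto
  qed
  obtain p where p: "p \<in> argmin_set ?h X"
    using argmin_set_nonempty[OF X(4,1) conth] by blast
  then have pX: "p \<in> X" and pmin: "\<And>u. u \<in> X \<Longrightarrow> ?h p \<le> ?h u"
    by (auto simp: argmin_set_def is_arg_min_def not_less)
  have nsum: "\<not> summable \<gamma>f"
  proof
    assume sum: "summable \<gamma>f"
    \<comment> \<open>The divergent sum starts at index 1 and \<open>suminf\<close> at 0; since the
      terms are nonnegative, the former stays below the latter.\<close>
    have le: "(\<Sum>k=1..N. \<gamma>f k) \<le> suminf \<gamma>f" for N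
      using sum \<gamma>0 by (intro sum_le_suminf) auto
    obtain N where "(\<Sum>k=1..N. \<gamma>f k) \<ge> suminf \<gamma>f + 1"
      using assms(19) by (metis eventually_sequentially filterlim_at_top order_refl)
    with le[of N] show False
      by linarith
  qed
  have small: "\<exists>k\<ge>n. ?h (x k) - ?h p < \<epsilon>" if "0 < \<epsilon>" for \<epsilon> n
  proof (rule divergent_weights_frequently_small[OF \<gamma>0 _ nsum _ that])
    show "0 \<le> ?h (x k) - ?h p" for k
      using pmin[OF xX] by simp
    show "summable (\<lambda>k. \<gamma>f k * (?h (x k) - ?h p))"
      using fejer[OF p] summable_cmult_iff[of 2 "\<lambda>k. \<gamma>f k * (?h (x k) - ?h p)"]
      by (simp add: mult.assoc)
  qed
  have "\<exists>z \<in> argmin_set ?h X. x \<longlonglongrightarrow> z"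
    using fejer_convergence_to_argmin[of X x ?h p, OF X(4) xX conth _ pX small pmin] fejer by blast
  then show ?thesis
    using arg \<theta>lim by blast
qed

end
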